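(* Let $G=(V,E)$ be a DAG with $|V|=n$ and maximum out-degree $d_{out}$. Then there exists an $r^{(top)}$-visit $\psi$ of $G$ such that: (a) if $d_{out}=0$, then $b_{r^{(top)}}(\psi)=0$; (b) if $d_{out}=1$, then $b_{r^{(top)}}(\psi)=1$; and (c) if $d_{out}\leq D$ for some $D\geq 2$, then $b_{r^{(top)}}(\psi)\leq \frac{D-1}{\log_2 D}\log_2 n+1$.
   Context: For a vertex $v$ of a finite DAG $G=(V,E)$, $\mathrm{pred}(v)=\{u : (u,v)\in E\}$ and $\mathrm{suc}(v)=\{u : (v,u)\in E\}$; the maximum out-degree is $\max_v|\mathrm{suc}(v)|$. A visit rule $r$ for $G$ assigns to each $v\in V$ a non-empty family $r(v)$ of subsets of $\mathrm{pred}(v)$, called enablers of $v$. An $r$-sequence is a sequence $\psi$ of distinct vertices such that for every $1\le i\le|\psi|$ the set of vertices of the prefix $\psi[1..i-1]$ contains some enabler $Q\in r(\psi[i])$. An $r$-visit is an $r$-sequence containing all $n$ vertices. The $r$-boundary of an $r$-sequence $\psi$ is $B_r(\psi)=\{v\in V\setminus\psi : \exists Q\neq\emptyset,\ Q\in r(v),\ Q\subseteq\psi\}$, and $b_r(\psi)=\max_{1\le i\le|\psi|}|B_r(\psi[1..i])|$. The topological rule is $r^{(top)}(v)=\{\mathrm{pred}(v)\}$ (so $r^{(top)}$-visits are exactly the topological orderings of $G$). *)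

theory Defs
  imports Complex_Main
begin

text \<open>
  A directed graph is given by a vertex set \<open>V\<close> and an edge relation \<open>E \<subseteq> V \<times> V\<close>;
  vertex sequences are lists.
\<close>

definition dag :: "'a set \<Rightarrow> ('a \<times> 'a) set \<Rightarrow> bool" where
  "dag V E \<longleftrightarrow> finite V \<and> E \<subseteq> V \<times> V \<and> acyclic E"

definition preds :: "('a \<times> 'a) set \<Rightarrow> 'a \<Rightarrow> 'a set" where
  "preds E v = {u. (u, v) \<in> E}"

definition succs :: "('a \<times> 'a) set \<Rightarrow> 'a \<Rightarrow> 'a set" where
  "succs E v = {u. (v, u) \<in> E}"

text \<open>
  On \<^typ>\<open>nat\<close>, the supremum of a finite non-empty set is its maximum, and the supremum
  of the empty set is \<open>0\<close>; the latter only matters for the empty graph and the empty sequence.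
\<close>

definition max_outdegree :: "'a set \<Rightarrow> ('a \<times> 'a) set \<Rightarrow> nat" where
  "max_outdegree V E = (SUP v\<in>V. card (succs E v))"

definition visit_rule :: "'a set \<Rightarrow> ('a \<times> 'a) set \<Rightarrow> ('a \<Rightarrow> 'a set set) \<Rightarrow> bool" where
  "visit_rule V E r \<longleftrightarrow> (\<forall>v\<in>V. r v \<noteq> {} \<and> (\<forall>Q\<in>r v. Q \<subseteq> preds E v))"

text \<open>
  Lists are indexed from \<open>0\<close>, so \<open>take i \<psi>\<close> is the prefix strictly before the entry \<open>\<psi> ! i\<close>.
\<close>

definition r_sequence :: "'a set \<Rightarrow> ('a \<Rightarrow> 'a set set) \<Rightarrow> 'a list \<Rightarrow> bool" where
  "r_sequence V r \<psi> \<longleftrightarrow> distinct \<psi> \<and> set \<psi> \<subseteq> V \<and>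
     (\<forall>i<length \<psi>. \<exists>Q\<in>r (\<psi> ! i). Q \<subseteq> set (take i \<psi>))"

definition r_visit :: "'a set \<Rightarrow> ('a \<Rightarrow> 'a set set) \<Rightarrow> 'a list \<Rightarrow> bool" where
  "r_visit V r \<psi> \<longleftrightarrow> r_sequence V r \<psi> \<and> set \<psi> = V"

definition r_boundary :: "'a set \<Rightarrow> ('a \<Rightarrow> 'a set set) \<Rightarrow> 'a list \<Rightarrow> 'a set" where
  "r_boundary V r \<psi> = {v \<in> V - set \<psi>. \<exists>Q\<in>r v. Q \<noteq> {} \<and> Q \<subseteq> set \<psi>}"

definition boundary_complexity :: "'a set \<Rightarrow> ('a \<Rightarrow> 'a set set) \<Rightarrow> 'a list \<Rightarrow> nat" where
  "boundary_complexity V r \<psi> = (SUP i\<in>{1..length \<psi>}. card (r_boundary V r (take i \<psi>)))"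

definition top_rule :: "('a \<times> 'a) set \<Rightarrow> 'a \<Rightarrow> 'a set set" where
  "top_rule E v = {preds E v}"

lemma visit_rule_top_rule: "visit_rule V E (top_rule E)"
  by (simp add: visit_rule_def top_rule_def)

end

theory Submission
  imports Defs "HOL-Analysis.Convex"
begin

text \<open>
  Call the cone of a visitable vertex \<open>v\<close> the set of all vertices that can be visited by starting
  with \<open>v\<close> and then using only vertices that become ready along the way. The cones of distinct
  visitable vertices are disjoint, and visiting the whole cone of \<open>v\<close> leaves the boundary as it was,
  except that \<open>v\<close> disappears. So among \<open>k\<close> pending vertices one first exhausts the smallest cone,
  while the other \<open>k - 1\<close> vertices wait. If \<open>T m\<close> is the boundary needed for a cone of size \<open>m\<close>, then
  \<open>T m \<le> max (k \<le> d) (T (m / k) + k - 1)\<close>, which solves to \<open>T m \<le> c * log 2 m + 1\<close> as soon as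
  \<open>k - 1 \<le> c * log 2 k\<close> for all \<open>1 \<le> k \<le> d\<close>; by concavity of the logarithm
  \<open>c = (d - 1) / log 2 d\<close> will do.
\<close>

section \<open>Ready vertices and cones\<close>

text \<open>For edges inside \<open>V\<close>, this is the boundary of the topological rule at
  visited set \<open>S\<close>. Sources never belong to it, their only enabler being empty.\<close>

definition ready :: "('a \<times> 'a) set \<Rightarrow> 'a set \<Rightarrow> 'a set" where
  "ready E S = {v. v \<notin> S \<and> preds E v \<noteq> {} \<and> preds E v \<subseteq> S}"

text \<open>Demanding a predecessor outside \<open>S\<close> in \<open>step\<close> keeps out
  vertices that are visitable at \<open>S\<close> anyway, such as unvisited sources, unless they are
  roots in \<open>K\<close>.\<close>

inductive_set dag_cone :: "('a \<times> 'a) set \<Rightarrow> 'a set \<Rightarrow> 'a set \<Rightarrow> 'a set"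
  for E S K where
  base: "v \<in> K \<Longrightarrow> v \<in> dag_cone E S K"
| step: "\<lbrakk>v \<notin> S; \<not> preds E v \<subseteq> S; \<forall>u \<in> preds E v. u \<in> S \<or> u \<in> dag_cone E S K\<rbrakk>
          \<Longrightarrow> v \<in> dag_cone E S K"

text \<open>Unlike \<open>ready\<close>, this admits sources, so that a cone can start at
  one.\<close>

definition visitable :: "('a \<times> 'a) set \<Rightarrow> 'a set \<Rightarrow> 'a set" where
  "visitable E S = {v. v \<notin> S \<and> preds E v \<subseteq> S}"

lemma finite_succs:
  assumes "finite V" "E \<subseteq> V \<times> V"
  shows "finite (succs E v)"
  by (rule finite_subset[OF _ assms(1)]) (use assms(2) in \<open>auto simp: succs_def\<close>)

lemma dag_cone_empty: "dag_cone E S {} = {}"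
  if "wf E"
proof -
  have "v \<notin> dag_cone E S {}" for v
    using that
  proof (induction v rule: wf_induct_rule)
    case (less v)
    show ?case
    proof
      assume "v \<in> dag_cone E S {}"
      then show False
        using less by cases (auto simp: preds_def)
    qed
  qed
  then show ?thesis by blast
qed

lemma dag_cone_disjoint_visited:
  assumes "K \<inter> S = {}"
  shows "dag_cone E S K \<inter> S = {}"
proof -
  have "v \<notin> S" if "v \<in> dag_cone E S K" for v
    using that assms by cases auto
  then show ?thesis by blast
qed

lemma dag_cone_subset:
  assumes "E \<subseteq> V \<times> V" "K \<subseteq> V"
  shows "dag_cone E S K \<subseteq> V"
proof
  fix v assume "v \<in> dag_cone E S K"
  then show "v \<in> V"
    using assms by cases (auto simp: preds_def)
qed

lemma dag_cone_mono:
  assumes "K \<subseteq> L"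
  shows "dag_cone E S K \<subseteq> dag_cone E S L"
proof
  fix v assume "v \<in> dag_cone E S K"
  then show "v \<in> dag_cone E S L"
    by induction (use assms in \<open>blast intro: dag_cone.intros\<close>)+
qed

lemma visitable_in_dag_cone_iff:
  assumes "v \<in> visitable E S"
  shows "v \<in> dag_cone E S K \<longleftrightarrow> v \<in> K"
proof
  assume "v \<in> dag_cone E S K"
  then show "v \<in> K"
    using assms by cases (auto simp: visitable_def)
qed (rule dag_cone.base)

text \<open>Were some predecessor of a ready vertex outside \<open>S\<close>, then
  \<open>step\<close> would have put that vertex into the cone. Hence exhausting a cone leaves no
  new pending vertices.\<close>

lemma ready_union_dag_cone: "ready E (S \<union> dag_cone E S K) \<subseteq> ready E S - K"
proof
  fix x assume x: "x \<in> ready E (S \<union> dag_cone E S K)"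
  have "preds E x \<subseteq> S"
    using x dag_cone.step[of x S E K] by (auto simp: ready_def)
  then show "x \<in> ready E S - K"
    using x dag_cone.base[of x K E S] by (auto simp: ready_def)
qed

text \<open>Recursion for one root: a vertex entering by \<open>step\<close> with all predecessors
  in \<open>insert v S\<close> is newly ready, hence a root once \<open>v\<close> is visited; any
  other still enters by \<open>step\<close>.\<close>

lemma dag_cone_singleton:
  assumes v: "v \<in> visitable E S"
  shows "dag_cone E S {v} = insert v (dag_cone E (insert v S) (ready E (insert v S) - ready E S))"
    (is "?L = insert v ?R")
proof (intro equalityI subsetI)
  fix x assume "x \<in> ?L"
  then show "x \<in> insert v ?R"
  proof induction
    case (step x)
    show ?case
    proof (cases "x = v \<or> preds E x \<subseteq> insert v S")
      case True
      then show ?thesis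
        using step.hyps by (auto simp: ready_def intro!: dag_cone.base)
    next
      case False
      then show ?thesis
        using step by (auto intro: dag_cone.step)
    qed
  qed simp
next
  fix x assume "x \<in> insert v ?R"
  moreover have "x \<in> ?L" if "x \<in> ?R"
    using that
  proof induction
    case (base x)
    then have "x \<notin> S" "\<not> preds E x \<subseteq> S" "preds E x \<subseteq> insert v S"
      by (auto simp: ready_def)
    then show ?case
      by (auto intro!: dag_cone.step[of x] intro: dag_cone.base)
  next
    case (step x)
    then have "x \<notin> S" "\<not> preds E x \<subseteq> S"
      by auto
    then show ?case
      by (rule dag_cone.step) (use step in \<open>auto intro: dag_cone.base\<close>)
  qed
  ultimately show "x \<in> ?L"
    by (auto intro: dag_cone.base)
qed

text \<open>Recursion for several roots. No vertex is lost in between: one with a predecessor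
  outside \<open>S\<close> and all predecessors in \<open>S\<close> or the first cone already lies
  in that cone.\<close>

lemma dag_cone_split:
  assumes "w \<in> K"
  shows "dag_cone E S K = dag_cone E S {w} \<union> dag_cone E (S \<union> dag_cone E S {w}) (K - {w})"
    (is "?L = ?C \<union> ?R")
proof (intro equalityI subsetI)
  fix x assume "x \<in> ?L"
  then show "x \<in> ?C \<union> ?R"
  proof induction
    case (base x)
    then show ?case by (cases "x = w") (auto intro: dag_cone.base)
  next
    case (step x)
    show ?case
    proof (cases "x \<in> ?C \<or> preds E x \<subseteq> S \<union> ?C")
      case True
      then show ?thesis
        using step.hyps dag_cone.step[of x S E "{w}"] by blast
    next
      case False
      then have "x \<in> ?R"
        by (intro dag_cone.step) (use step in auto)
      then show ?thesis by simp
    qed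
  qed
next
  have C: "?C \<subseteq> ?L"
    using assms by (intro dag_cone_mono) auto
  fix x assume "x \<in> ?C \<union> ?R"
  moreover have "x \<in> ?L" if "x \<in> ?R"
    using that
  proof induction
    case (step x)
    then have "x \<notin> S" "\<not> preds E x \<subseteq> S"
      by auto
    then show ?case
      by (rule dag_cone.step) (use step C in auto)
  qed (auto intro: dag_cone.base)
  ultimately show "x \<in> ?L"
    using C by auto
qed

text \<open>A common vertex entering by \<open>step\<close> has a predecessor outside
  \<open>S\<close>, which is again common. The descent ends at a root, and a visitable vertex lies
  in a cone only as its root.\<close>

lemma dag_cones_disjoint:
  assumes "v \<in> visitable E S" "w \<in> visitable E S" "v \<noteq> w"
  shows "dag_cone E S {v} \<inter> dag_cone E S {w} = {}"
proof -
  have "x \<notin> dag_cone E S {w}" if "x \<in> dag_cone E S {v}" for x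
    using that
  proof induction
    case (base x)
    then show ?case
      using assms visitable_in_dag_cone_iff[of v E S "{w}"] by auto
  next
    case (step x)
    show ?case
    proof
      assume "x \<in> dag_cone E S {w}"
      then show False
        by cases (use step assms in \<open>auto simp: visitable_def\<close>)
    qed
  qed
  then show ?thesis by blast
qed

text \<open>The cones of single roots are disjoint parts of the cone of \<open>K\<close>, so the
  smallest has at most average size.\<close>

lemma smallest_dag_cone:
  assumes "finite V" "E \<subseteq> V \<times> V" "K \<subseteq> V \<inter> visitable E S" "K \<noteq> {}"
  obtains w where "w \<in> K" "card K * card (dag_cone E S {w}) \<le> card (dag_cone E S K)"
proof -
  let ?f = "\<lambda>w. card (dag_cone E S {w})"
  have fin: "finite K" "\<And>L. L \<subseteq> V \<Longrightarrow> finite (dag_cone E S L)"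
    using assms(1,3) finite_subset[OF dag_cone_subset[OF assms(2)] assms(1)]
    by (auto intro: finite_subset)
  obtain w where w: "w \<in> K" "\<And>u. u \<in> K \<Longrightarrow> ?f w \<le> ?f u"
    using ex_is_arg_min_if_finite[OF fin(1) assms(4), of ?f] by (auto simp: is_arg_min_linorder)
  have "card K * ?f w \<le> (\<Sum>u\<in>K. ?f u)"
    using sum_bounded_below[of K "?f w" ?f] w(2) by simp
  also have "\<dots> = card (\<Union>u\<in>K. dag_cone E S {u})"
    using fin assms(3) dag_cones_disjoint[of _ E S]
    by (subst card_UN_disjoint) (auto, blast)
  also have "\<dots> \<le> card (dag_cone E S K)"
    using fin(2)[of K] assms(3) by (intro card_mono UN_least dag_cone_mono) auto
  finally show ?thesis using w(1) that by blast
qed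

section \<open>Visiting the smallest cone first\<close>

text \<open>The parameter \<open>S\<close> allows visits of successive cones to be
  concatenated.\<close>

fun topological_from :: "('a \<times> 'a) set \<Rightarrow> 'a set \<Rightarrow> 'a list \<Rightarrow> bool" where
  "topological_from E S [] \<longleftrightarrow> True"
| "topological_from E S (x # xs) \<longleftrightarrow> preds E x \<subseteq> S \<and> topological_from E (insert x S) xs"

lemma topological_from_append:
  "topological_from E S (xs @ ys) \<longleftrightarrow>
    topological_from E S xs \<and> topological_from E (S \<union> set xs) ys"
  by (induction xs arbitrary: S) auto

lemma topological_from_nth:
  "topological_from E S xs \<Longrightarrow> i < length xs \<Longrightarrow> preds E (xs ! i) \<subseteq> S \<union> set (take i xs)"
proof (induction xs arbitrary: S i)
  case (Cons x xs)
  show ?case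
  proof (cases i)
    case 0
    then show ?thesis using Cons.prems by simp
  next
    case (Suc j)
    then show ?thesis using Cons.IH[of "insert x S" j] Cons.prems by simp
  qed
qed simp

text \<open>The default \<open>log 2 0 = 0\<close> extends monotonicity to \<open>m = 0\<close>;
  this covers empty cones and yields nonnegativity of the bound.\<close>

lemma log_nat_mono:
  fixes c :: real
  assumes "0 \<le> c" "m \<le> n"
  shows "c * log 2 (real m) \<le> c * log 2 (real n)"
proof (cases "m = 0")
  case True
  then show ?thesis
    using assms by (cases "n = 0") (auto simp: log_def)
next
  case False
  then show ?thesis
    using assms by (intro mult_left_mono) auto
qed

text \<open>Vertices of \<open>ready E S - K\<close> wait outside the cone throughout, so the count
  omits them; this makes the bounds of nested cones combine. The \<open>max 1 d\<close> admits a
  single root even if \<open>d = 0\<close>.\<close>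

lemma dag_cone_visit:
  fixes c :: real
  assumes V: "finite V" "E \<subseteq> V \<times> V" and E: "wf E"
    and d: "\<And>v. v \<in> V \<Longrightarrow> card (succs E v) \<le> d"
    and c: "0 \<le> c" "\<And>j. 1 \<le> j \<Longrightarrow> j \<le> d \<Longrightarrow> real j - 1 \<le> c * log 2 (real j)"
    and K: "K \<subseteq> V \<inter> visitable E S" "card K \<le> max 1 d"
  shows "\<exists>xs. distinct xs \<and> set xs = dag_cone E S K \<and> topological_from E S xs \<and>
    (\<forall>i. real (card (ready E (S \<union> set (take i xs)) - (ready E S - K)))
          \<le> c * log 2 (real (card (dag_cone E S K))) + 1)"
  using K
proof (induction "card (dag_cone E S K)" arbitrary: S K rule: less_induct)
  case less
  have fin_cone: "finite (dag_cone E T L)" if "L \<subseteq> V" for T L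
    using that V dag_cone_subset by (metis finite_subset)
  have ready_V: "ready E T \<subseteq> V" for T
    using V(2) by (auto simp: ready_def preds_def)
  have fin_ready: "finite (ready E T)" for T
    using ready_V V(1) by (rule finite_subset)
  have fin: "finite K"
    using less.prems V(1) by (auto intro: finite_subset)
  have disj: "K \<inter> S = {}"
    using less.prems by (auto simp: visitable_def)
  consider "K = {}" | v where "K = {v}" | "card K \<ge> 2"
  proof -
    have "card K = 0 \<or> card K = 1 \<or> card K \<ge> 2"
      by linarith
    then show ?thesis
      using fin that by (auto simp: card_1_singleton_iff)
  qed
  then show ?case
  proof cases
    case 1
    then show ?thesis
      by (intro exI[of _ "[]"]) (simp add: dag_cone_empty[OF E] log_def)
  next
    case (2 v)
    let ?S = "insert v S" and ?K = "ready E (insert v S) - ready E S"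
    let ?m = "card (dag_cone E S K)" and ?m' = "card (dag_cone E ?S ?K)"
    have v: "v \<in> visitable E S" "v \<in> V"
      using 2 less.prems by auto
    have cone: "dag_cone E S K = insert v (dag_cone E ?S ?K)"
      using dag_cone_singleton[OF v(1)] 2 by simp
    have fresh: "v \<notin> dag_cone E ?S ?K"
      using dag_cone_disjoint_visited[of ?K ?S E] by (auto simp: ready_def)
    have "?m = Suc ?m'"
      using cone fresh fin_cone[of ?K ?S] ready_V by (metis card_insert_disjoint Diff_subset subset_trans)
    moreover have "?K \<subseteq> V \<inter> visitable E ?S"
      using ready_V by (auto simp: ready_def visitable_def)
    moreover have "card ?K \<le> max 1 d"
    proof -
      \<comment> \<open>A newly ready vertex must have \<open>v\<close> as a predecessor.\<close>
      have "?K \<subseteq> succs E v"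
        by (auto simp: ready_def succs_def preds_def)
      moreover have "finite (succs E v)"
        using V by (rule finite_succs)
      ultimately have "card ?K \<le> card (succs E v)"
        by (rule card_mono[rotated])
      then show ?thesis using d[OF v(2)] by simp
    qed
    ultimately obtain xs where xs: "distinct xs" "set xs = dag_cone E ?S ?K" "topological_from E ?S xs"
      and bound: "\<And>i. real (card (ready E (?S \<union> set (take i xs)) - (ready E ?S - ?K)))
          \<le> c * log 2 (real ?m') + 1"
      using less.hyps[of ?S ?K] by auto
    have "real (card (ready E (S \<union> set (take i (v # xs))) - (ready E S - K)))
        \<le> c * log 2 (real ?m) + 1" for i
    proof (cases i)
      case 0
      \<comment> \<open>Before \<open>v\<close> is visited, at most \<open>v\<close> itself counts;
        the summand 1 of the bound pays for it.\<close>
      have "card (ready E S - (ready E S - K)) \<le> card K"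
        using fin by (intro card_mono) auto
      moreover have "0 \<le> c * log 2 (real ?m)"
        using log_nat_mono[OF c(1), of 0 ?m] by (simp add: log_def)
      ultimately show ?thesis using 0 2 by auto
    next
      case (Suc j)
      \<comment> \<open>The goal omits at least what the induction hypothesis omits, so its count is
        no larger.\<close>
      have "ready E ?S - ?K \<subseteq> ready E S - K"
        using 2 by (auto simp: ready_def)
      then have "card (ready E (S \<union> set (take i (v # xs))) - (ready E S - K))
          \<le> card (ready E (?S \<union> set (take j xs)) - (ready E ?S - ?K))"
        using Suc fin_ready by (intro card_mono) auto
      moreover have "c * log 2 (real ?m') \<le> c * log 2 (real ?m)"
        using \<open>?m = Suc ?m'\<close> c(1) by (intro log_nat_mono) auto
      ultimately show ?thesis
        using bound[of j] by linarith
    qed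
    moreover have "distinct (v # xs)" "set (v # xs) = dag_cone E S K" "topological_from E S (v # xs)"
      using xs fresh cone v by (auto simp: visitable_def)
    ultimately show ?thesis by blast
  next
    case 3
    let ?m = "card (dag_cone E S K)" and ?k = "card K"
    have "K \<noteq> {}"
      using 3 by auto
    then obtain w where w: "w \<in> K" and small: "?k * card (dag_cone E S {w}) \<le> ?m"
      using smallest_dag_cone[OF V less.prems(1)] by metis
    let ?C = "dag_cone E S {w}"
    let ?S = "S \<union> ?C" and ?K = "K - {w}"
    let ?m1 = "card ?C" and ?m2 = "card (dag_cone E ?S ?K)"
    have wv: "w \<in> V" "w \<in> visitable E S"
      using w less.prems by auto
    have cone: "dag_cone E S K = ?C \<union> dag_cone E ?S ?K"
      using w by (rule dag_cone_split)
    have K_disj: "?K \<inter> ?S = {}"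
      using disj less.prems visitable_in_dag_cone_iff[of _ E S "{w}"] by auto
    have fresh: "?C \<inter> dag_cone E ?S ?K = {}"
      using dag_cone_disjoint_visited[OF K_disj, of E] by auto
    have finC: "finite ?C" "finite (dag_cone E ?S ?K)"
      using fin_cone[of "{w}" S] fin_cone[of ?K ?S] wv less.prems by auto
    have m: "?m = ?m1 + ?m2"
      unfolding cone using finC fresh by (rule card_Un_disjoint)
    have m1: "0 < ?m1"
      using finC dag_cone.base[of w "{w}" E S] by (auto simp: card_gt_0_iff)
    \<comment> \<open>With two or more roots the smallest cone is strictly smaller than the whole,
      so induction applies to it.\<close>
    have "2 * ?m1 \<le> ?k * ?m1"
      using 3 by simp
    then have "?m1 < ?m"
      using small m1 by linarith
    then obtain xs where xs: "distinct xs" "set xs = ?C" "topological_from E S xs"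
      and bound1: "\<And>i. real (card (ready E (S \<union> set (take i xs)) - (ready E S - {w})))
          \<le> c * log 2 (real ?m1) + 1"
      using less.hyps[of S "{w}"] wv by auto
    have "?K \<subseteq> V \<inter> visitable E ?S"
      using less.prems K_disj by (auto simp: visitable_def)
    moreover have "card ?K \<le> max 1 d"
      using less.prems(2) card_Diff1_le[of K w] by linarith
    moreover have "?m2 < ?m"
      using m m1 by simp
    ultimately obtain ys where ys: "distinct ys" "set ys = dag_cone E ?S ?K" "topological_from E ?S ys"
      and bound2: "\<And>i. real (card (ready E (?S \<union> set (take i ys)) - (ready E ?S - ?K)))
          \<le> c * log 2 (real ?m2) + 1"
      using less.hyps[of ?S ?K] by auto
    have "real (card (ready E (S \<union> set (take i (xs @ ys))) - (ready E S - K)))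
        \<le> c * log 2 (real ?m) + 1" for i
    proof (cases "i \<le> length xs")
      case True
      let ?R = "ready E (S \<union> set (take i xs))"
      \<comment> \<open>While the cone of \<open>w\<close> is visited, the other
        \<open>k - 1\<close> roots wait; they count here but not in the induction
        hypothesis.\<close>
      have "?R - (ready E S - K) \<subseteq> (?R - (ready E S - {w})) \<union> ?K"
        by auto
      then have "card (?R - (ready E S - K)) \<le> card ((?R - (ready E S - {w})) \<union> ?K)"
        using fin fin_ready by (intro card_mono) auto
      also have "\<dots> \<le> card (?R - (ready E S - {w})) + card ?K"
        by (rule card_Un_le)
      finally have "real (card (?R - (ready E S - K))) \<le> c * log 2 (real ?m1) + 1 + (real ?k - 1)"
        using bound1[of i] w fin 3 by (simp add: of_nat_diff)
      \<comment> \<open>As \<open>2 \<le> k\<close>, the bound \<open>max 1 d\<close> gives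
        \<open>k \<le> d\<close>, so the choice of \<open>c\<close> pays for the waiting roots; the
        logarithms then merge and \<open>k * m1 \<le> m\<close> applies.\<close>
      also have "\<dots> \<le> c * log 2 (real ?m1) + 1 + c * log 2 (real ?k)"
        using c(2)[of ?k] 3 less.prems(2) by (simp add: le_max_iff_disj)
      also have "\<dots> = c * log 2 (real (?k * ?m1)) + 1"
        using m1 3 by (simp add: log_mult distrib_left)
      also have "\<dots> \<le> c * log 2 (real ?m) + 1"
        using log_nat_mono[OF c(1) small] by simp
      finally show ?thesis using True by simp
    next
      case False
      let ?R = "ready E (?S \<union> set (take (i - length xs) ys))"
      \<comment> \<open>The finished cone left nothing new pending, so no extra charge arises for
        the remaining roots.\<close>
      have "ready E ?S - ?K \<subseteq> ready E S - K"
        using ready_union_dag_cone[of E S "{w}"] by auto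
      then have "card (?R - (ready E S - K)) \<le> card (?R - (ready E ?S - ?K))"
        using fin_ready by (intro card_mono) auto
      moreover have "c * log 2 (real ?m2) \<le> c * log 2 (real ?m)"
        using m c(1) by (intro log_nat_mono) auto
      ultimately show ?thesis
        using bound2[of "i - length xs"] False xs(2) by (simp add: Un_assoc)
    qed
    moreover have "distinct (xs @ ys)" "set (xs @ ys) = dag_cone E S K"
      "topological_from E S (xs @ ys)"
      using xs ys fresh cone by (auto simp: topological_from_append)
    ultimately show ?thesis by blast
  qed
qed

text \<open>Whole cones are visited one after another. Each leaves the ready set empty, so their
  boundaries never accumulate.\<close>

lemma topological_visit:
  fixes c :: real
  assumes V: "finite V" "E \<subseteq> V \<times> V" and E: "wf E"
    and d: "\<And>v. v \<in> V \<Longrightarrow> card (succs E v) \<le> d"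
    and c: "0 \<le> c" "\<And>j. 1 \<le> j \<Longrightarrow> j \<le> d \<Longrightarrow> real j - 1 \<le> c * log 2 (real j)"
    and S: "S \<subseteq> V" "ready E S = {}"
  shows "\<exists>xs. distinct xs \<and> set xs = V - S \<and> topological_from E S xs \<and>
    (\<forall>i. real (card (ready E (S \<union> set (take i xs)))) \<le> c * log 2 (real (card V)) + 1)"
  using S
proof (induction "card (V - S)" arbitrary: S rule: less_induct)
  case less
  show ?case
  proof (cases "V = S")
    case True
    have "0 \<le> c * log 2 (real (card V))"
      using log_nat_mono[OF c(1), of 0 "card V"] by (simp add: log_def)
    then show ?thesis
      using True less.prems by (intro exI[of _ "[]"]) simp
  next
    case False
    \<comment> \<open>A minimal unvisited vertex has all its predecessors in \<open>S\<close>; as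
      nothing is ready, it is a source.\<close>
    then obtain v where v: "v \<in> V - S" "\<And>u. (u, v) \<in> E \<Longrightarrow> u \<notin> V - S"
      using less.prems wfE_min[OF E, of _ "V - S"] by blast
    then have visit: "v \<in> V" "v \<in> visitable E S"
      using V(2) by (auto simp: visitable_def preds_def)
    let ?C = "dag_cone E S {v}"
    obtain xs where xs: "distinct xs" "set xs = ?C" "topological_from E S xs"
      and bound1: "\<And>i. real (card (ready E (S \<union> set (take i xs)))) \<le> c * log 2 (real (card ?C)) + 1"
      \<comment> \<open>Since \<open>ready E S\<close> is empty, nothing is omitted and the bound
        concerns the full boundary.\<close>
      using dag_cone_visit[OF V E d c, of "{v}" S] visit less.prems by auto
    have C: "v \<in> ?C" "?C \<subseteq> V" "?C \<inter> S = {}"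
      using visit v dag_cone_subset[OF V(2), of "{v}" S] dag_cone_disjoint_visited[of "{v}" S E]
      by (auto intro: dag_cone.base)
    have "card (V - (S \<union> ?C)) < card (V - S)"
      using V(1) C v by (intro psubset_card_mono) auto
    moreover have "ready E (S \<union> ?C) = {}"
      using ready_union_dag_cone[of E S "{v}"] less.prems by auto
    ultimately obtain ys where ys: "distinct ys" "set ys = V - (S \<union> ?C)"
        "topological_from E (S \<union> ?C) ys"
      and bound2: "\<And>i. real (card (ready E (S \<union> ?C \<union> set (take i ys))))
          \<le> c * log 2 (real (card V)) + 1"
      using less.hyps[of "S \<union> ?C"] less.prems C by auto
    have "real (card (ready E (S \<union> set (take i (xs @ ys))))) \<le> c * log 2 (real (card V)) + 1" for i
    proof (cases "i \<le> length xs")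
      case True
      have "c * log 2 (real (card ?C)) \<le> c * log 2 (real (card V))"
        using C V(1) c(1) by (intro log_nat_mono card_mono) auto
      then show ?thesis
        using bound1[of i] True by simp
    next
      case False
      then show ?thesis
        using bound2[of "i - length xs"] xs(2) by (simp add: Un_assoc)
    qed
    moreover have "distinct (xs @ ys)" "set (xs @ ys) = V - S" "topological_from E S (xs @ ys)"
      using xs ys C by (auto simp: topological_from_append)
    ultimately show ?thesis by blast
  qed
qed

section \<open>Boundary complexity\<close>

lemma r_boundary_top_rule:
  assumes "E \<subseteq> V \<times> V"
  shows "r_boundary V (top_rule E) xs = ready E (set xs)"
  using assms by (auto simp: r_boundary_def top_rule_def ready_def preds_def)

lemma real_SUP_le:
  fixes f :: "'b \<Rightarrow> nat"
  assumes "finite A" "\<And>x. x \<in> A \<Longrightarrow> real (f x) \<le> b" "0 \<le> b"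
  shows "real (SUP x\<in>A. f x) \<le> b"
proof (cases "A = {}")
  case False
  then have "(SUP x\<in>A. f x) \<in> f ` A"
    using assms(1) by (simp add: cSup_eq_Max)
  then show ?thesis using assms(2) by auto
qed (use assms in simp)

lemma card_succs_le_max_outdegree:
  assumes "finite V" "v \<in> V"
  shows "card (succs E v) \<le> max_outdegree V E"
  unfolding max_outdegree_def using assms by (intro cSUP_upper) auto

text \<open>By concavity, the logarithm on the interval from 1 to \<open>D\<close> lies above its
  chord, which runs from 0 to \<open>log 2 D\<close>.\<close>

lemma minus_one_le_log:
  fixes j D :: nat
  assumes "1 \<le> j" "j \<le> D" "2 \<le> D"
  shows "real j - 1 \<le> (real D - 1) / log 2 (real D) * log 2 (real j)"
proof -
  \<comment> \<open>The weight of \<open>D\<close> when \<open>j\<close> is written as a convex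
    combination of 1 and \<open>D\<close>.\<close>
  define t where "t = (real j - 1) / (real D - 1)"
  have t: "0 \<le> t" "t \<le> 1"
    using assms by (auto simp: t_def)
  have "t * (real D - 1) = real j - 1"
    using assms by (simp add: t_def)
  then have j: "(1 - t) * 1 + t * real D = real j"
    by (simp add: algebra_simps)
  have "convex_on {0<..} (\<lambda>x. - log 2 x)"
    by (rule minus_log_convex) simp
  then have "t * log 2 (real D) \<le> log 2 (real j)"
    using convex_onD[of "{0<..}" "\<lambda>x. - log 2 x" t 1 "real D"] t j assms by simp
  then have "t * log 2 (real D) * (real D - 1) \<le> log 2 (real j) * (real D - 1)"
    using assms by (intro mult_right_mono) auto
  then have "(real j - 1) * log 2 (real D) \<le> (real D - 1) * log 2 (real j)"
    using assms by (simp add: t_def mult.commute)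
  then show ?thesis
    using assms by (simp add: pos_le_divide_eq)
qed

text \<open>Just before the head of an edge is visited, all its predecessors have been visited, so
  it lies in the boundary.\<close>

lemma boundary_complexity_pos:
  assumes "E \<subseteq> V \<times> V" "E \<noteq> {}" "finite V" "r_visit V (top_rule E) \<psi>"
  shows "0 < boundary_complexity V (top_rule E) \<psi>"
proof -
  obtain u v where uv: "(u, v) \<in> E" using assms(2) by auto
  then have "v \<in> set \<psi>"
    using assms(1,4) by (auto simp: r_visit_def)
  then obtain k where k: "k < length \<psi>" "\<psi> ! k = v"
    by (auto simp: in_set_conv_nth)
  have "distinct \<psi>" "preds E v \<subseteq> set (take k \<psi>)"
    using assms(4) k by (auto simp: r_visit_def r_sequence_def top_rule_def)
  moreover from this have "v \<notin> set (take k \<psi>)"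
    using k by (auto simp: in_set_conv_nth nth_eq_iff_index_eq)
  ultimately have "v \<in> r_boundary V (top_rule E) (take k \<psi>)" and k1: "1 \<le> k"
    \<comment> \<open>The prefix contains \<open>u\<close>, so it is not the empty one, which the
      supremum skips.\<close>
    using uv assms(1) by (auto simp: r_boundary_top_rule ready_def preds_def Suc_le_eq intro: gr0I)
  moreover have "finite (r_boundary V (top_rule E) (take k \<psi>))"
    using assms(3) by (simp add: r_boundary_def)
  ultimately have "0 < card (r_boundary V (top_rule E) (take k \<psi>))"
    by (auto simp: card_gt_0_iff)
  also have "\<dots> \<le> boundary_complexity V (top_rule E) \<psi>"
    unfolding boundary_complexity_def using k k1 by (intro cSUP_upper) auto
  finally show ?thesis .
qed

theorem theorem16:
  fixes V :: "'a set" and E :: "('a \<times> 'a) set" and n :: nat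
  assumes "dag V E" and "card V = n"
  shows "\<exists>\<psi>. r_visit V (top_rule E) \<psi> \<and>
    (max_outdegree V E = 0 \<longrightarrow> boundary_complexity V (top_rule E) \<psi> = 0) \<and>
    (max_outdegree V E = 1 \<longrightarrow> boundary_complexity V (top_rule E) \<psi> = 1) \<and>
    (\<forall>D::nat. 2 \<le> D \<and> max_outdegree V E \<le> D \<longrightarrow>
       real (boundary_complexity V (top_rule E) \<psi>)
         \<le> (real D - 1) / log 2 (real D) * log 2 (real n) + 1)"
proof -
  have V: "finite V" "E \<subseteq> V \<times> V" and "acyclic E"
    using assms(1) by (auto simp: dag_def)
  have "wf E"
    using V \<open>acyclic E\<close> by (meson finite_SigmaI finite_acyclic_wf finite_subset)
  define d where "d = max_outdegree V E"
  \<comment> \<open>For \<open>d \<le> 1\<close> at most \<open>j = 1\<close> has to be covered,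
    where 0 suffices; otherwise \<open>c\<close> comes from the chord estimate.\<close>
  define c where "c = (if d \<le> 1 then 0 else (real d - 1) / log 2 (real d))"
  have c: "0 \<le> c" "\<And>j. 1 \<le> j \<Longrightarrow> j \<le> d \<Longrightarrow> real j - 1 \<le> c * log 2 (real j)"
    using minus_one_le_log[of _ d] by (auto simp: c_def)
  have succs_le: "card (succs E v) \<le> d" if "v \<in> V" for v
    unfolding d_def using V(1) that by (rule card_succs_le_max_outdegree)
  obtain \<psi> where \<psi>: "distinct \<psi>" "set \<psi> = V" "topological_from E {} \<psi>"
    and bound: "\<And>i. real (card (ready E (set (take i \<psi>)))) \<le> c * log 2 (real n) + 1"
    using topological_visit[OF V \<open>wf E\<close> succs_le c, of "{}"] assms(2) by (auto simp: ready_def)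
  have visit: "r_visit V (top_rule E) \<psi>"
    using \<psi> topological_from_nth[OF \<psi>(3)] by (auto simp: r_visit_def r_sequence_def top_rule_def)
  have log_n: "0 \<le> log 2 (real n)"
    using log_nat_mono[of 1 0 n] by (simp add: log_def)
  let ?b = "boundary_complexity V (top_rule E) \<psi>"
  have b: "real ?b \<le> c * log 2 (real n) + 1"
    unfolding boundary_complexity_def using bound log_n c(1)
    by (intro real_SUP_le) (auto simp: r_boundary_top_rule[OF V(2)])
  \<comment> \<open>The general bound only gives 1 here; instead, without edges there is no nonempty
    enabler.\<close>
  have case_a: "?b = 0" if "d = 0"
  proof -
    have "succs E v = {}" if "v \<in> V" for v
      using succs_le[OF that] \<open>d = 0\<close> finite_succs[OF V, of v] by simp
    then have "E = {}"
      using V(2) by (auto simp: succs_def)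
    then have "real ?b \<le> 0"
      unfolding boundary_complexity_def
      by (intro real_SUP_le) (auto simp: r_boundary_def top_rule_def preds_def)
    then show ?thesis by simp
  qed
  \<comment> \<open>With \<open>c = 0\<close> the general bound is 1, and an edge forces a positive
    value.\<close>
  have case_b: "?b = 1" if "d = 1"
  proof -
    have "E \<noteq> {}"
    proof
      assume "E = {}"
      then have "real d \<le> 0"
        unfolding d_def max_outdegree_def using V(1) by (intro real_SUP_le) (auto simp: succs_def)
      then show False using that by simp
    qed
    then have "0 < ?b"
      using V visit by (intro boundary_complexity_pos)
    then show ?thesis using b that by (simp add: c_def)
  qed
  have case_c: "real ?b \<le> (real D - 1) / log 2 (real D) * log 2 (real n) + 1"
    if "2 \<le> D" "d \<le> D" for D
  proof -
    \<comment> \<open>The visit was built for \<open>d\<close>, yet serves every \<open>D\<close>: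
      the chord estimate at \<open>j = d\<close> shows that the quotient for \<open>d\<close> is at
      most that for \<open>D\<close>.\<close>
    have "c \<le> (real D - 1) / log 2 (real D)"
      using minus_one_le_log[of d D] that by (auto simp: c_def pos_divide_le_eq)
    then show ?thesis
      using b mult_right_mono[OF _ log_n] by fastforce
  qed
  show ?thesis
    unfolding d_def[symmetric]
    by (intro exI[of _ \<psi>] conjI allI impI visit case_a case_b case_c) simp_all
qed

end
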